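(* Let $n,m\ge 1$ be integers, let $A\in\mathbb{R}^{n\times m}$, and fix $k\in\{1,\dots,\min\{n,m\}\}$. Then $$A^{(k)} = L_{n,k}\, A^{\otimes k}\, M_{m,k}.$$
   Context: For integers $n\ge 1$ and $k\in\{1,\dots,n\}$, $Q(n,k)$ denotes the list of all strictly increasing sequences $(i_1,\dots,i_k)$ of $k$ integers in $\{1,\dots,n\}$, ordered lexicographically. For $A\in\mathbb{R}^{n\times m}$ and $k\in\{1,\dots,\min\{n,m\}\}$, the $k$-multiplicative compound $A^{(k)}$ is the $\binom{n}{k}\times\binom{m}{k}$ matrix of all $k\times k$ minors of $A$ in lexicographic order: its entry in the row indexed by $\alpha\in Q(n,k)$ and the column indexed by $\beta\in Q(m,k)$ is the minor of $A$ with rows $\alpha$ and columns $\beta$. In particular, for $x^1,\dots,x^k\in\mathbb{R}^n$, $\begin{bmatrix}x^1&\dots&x^k\end{bmatrix}^{(k)}$ is a column vector in $\mathbb{R}^{\binom{n}{k}}$. $\otimes$ is the Kronecker product, and $A^{\otimes k}$ is the Kronecker power: $A^{\otimes 1}=A$, $A^{\otimes k}=A^{\otimes(k-1)}\otimes A$. Let $e^1,\dots,e^n$ be the canonical basis of $\mathbb{R}^n$. The matrices $M_{n,k}\in\mathbb{R}^{n^k\times\binom{n}{k}}$ and $L_{n,k}\in\mathbb{R}^{\binom{n}{k}\times n^k}$ are $$M_{n,k}:=\sum_{(i_1,\dots,i_k)\in Q(n,k)}\ \sum_{(j_1,\dots,j_k)\in S(i_1,\dots,i_k)}\sigma(j_1,\dots,j_k)\,(e^{j_1}\otimes\dots\otimes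 e^{j_k})\left(\begin{bmatrix}e^{i_1}&\dots&e^{i_k}\end{bmatrix}^{(k)}\right)^T,$$ $$L_{n,k}:=\sum_{(i_1,\dots,i_k)\in Q(n,k)}\begin{bmatrix}e^{i_1}&\dots&e^{i_k}\end{bmatrix}^{(k)}(e^{i_1}\otimes\dots\otimes e^{i_k})^T,$$ where $S(i_1,\dots,i_k)$ is the set of all permutations (rearrangements) of the sequence $(i_1,\dots,i_k)$ and $\sigma(j_1,\dots,j_k)\in\{-1,1\}$ is the signature of the permutation $(j_1,\dots,j_k)$ relative to increasing order. *)

theory Defs
  imports
    "Jordan_Normal_Form.Determinant"
    "HOL-Library.List_Lexorder"
    "HOL-Combinatorics.Multiset_Permutations"
begin

text \<open>
  Rows, columns and basis vectors are numbered from \<open>0\<close>, as usual for \<^typ>\<open>'a mat\<close>: the index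
  sequences take their values in \<open>{..<n}\<close> rather than \<open>{1..n}\<close>. A vector in a product of
  matrices is a one-column matrix.
\<close>

section \<open>Increasing index sequences and multiplicative compounds\<close>

definition incr_seqs :: "nat \<Rightarrow> nat \<Rightarrow> nat list set" where
  "incr_seqs n k = {is. length is = k \<and> sorted_wrt (<) is \<and> set is \<subseteq> {..<n}}"

text \<open>
  \<open>Q(n,k)\<close>. The order on \<^typ>\<open>nat list\<close> used by \<^const>\<open>sorted_list_of_set\<close> is the
  lexicographic one of \<^theory>\<open>HOL-Library.List_Lexorder\<close>.
\<close>

definition lex_seqs :: "nat \<Rightarrow> nat \<Rightarrow> nat list list" where
  "lex_seqs n k = sorted_list_of_set (incr_seqs n k)"

definition minor :: "'a :: comm_ring_1 mat \<Rightarrow> nat list \<Rightarrow> nat list \<Rightarrow> 'a" where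
  "minor A \<alpha> \<beta> = det (mat (length \<alpha>) (length \<beta>) (\<lambda>(r, s). A $$ (\<alpha> ! r, \<beta> ! s)))"

definition compound :: "nat \<Rightarrow> 'a :: comm_ring_1 mat \<Rightarrow> 'a mat" where
  "compound k A = mat (dim_row A choose k) (dim_col A choose k)
     (\<lambda>(i, j). minor A (lex_seqs (dim_row A) k ! i) (lex_seqs (dim_col A) k ! j))"

lemma finite_incr_seqs [simp]: "finite (incr_seqs n k)"
proof (rule finite_subset)
  show "incr_seqs n k \<subseteq> {is. set is \<subseteq> {..<n} \<and> length is = k}"
    by (auto simp: incr_seqs_def)
  show "finite {is :: nat list. set is \<subseteq> {..<n} \<and> length is = k}"
    by (rule finite_lists_length_eq) simp
qed

lemma set_lex_seqs [simp]: "set (lex_seqs n k) = incr_seqs n k"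
  by (simp add: lex_seqs_def)

lemma card_incr_seqs: "card (incr_seqs n k) = n choose k"
proof -
  have "bij_betw set (incr_seqs n k) {B. B \<subseteq> {..<n} \<and> card B = k}"
  proof (rule bij_betwI[where g = sorted_list_of_set])
    show "set \<in> incr_seqs n k \<rightarrow> {B. B \<subseteq> {..<n} \<and> card B = k}"
      by (auto simp: incr_seqs_def strict_sorted_iff distinct_card)
    show "sorted_list_of_set \<in> {B. B \<subseteq> {..<n} \<and> card B = k} \<rightarrow> incr_seqs n k"
    proof
      fix B assume B: "B \<in> {B. B \<subseteq> {..<n} \<and> card B = k}"
      then have "finite B"
        using finite_subset by auto
      with B show "sorted_list_of_set B \<in> incr_seqs n k"
        by (auto simp: incr_seqs_def)
    qed
    show "sorted_list_of_set (set is) = is" if "is \<in> incr_seqs n k" for "is"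
      using that by (simp add: incr_seqs_def sorted_list_of_set.idem_if_sorted_distinct
          strict_sorted_iff)
    show "set (sorted_list_of_set B) = B" if "B \<in> {B. B \<subseteq> {..<n} \<and> card B = k}" for B
      using that finite_subset[of B "{..<n}"] by simp
  qed
  then show ?thesis
    by (simp add: bij_betw_same_card n_subsets)
qed

lemma length_lex_seqs [simp]: "length (lex_seqs n k) = n choose k"
  by (simp add: lex_seqs_def card_incr_seqs)

section \<open>Kronecker products and powers\<close>

definition kronecker :: "'a :: semiring_1 mat \<Rightarrow> 'a mat \<Rightarrow> 'a mat" where
  "kronecker A B = mat (dim_row A * dim_row B) (dim_col A * dim_col B)
     (\<lambda>(i, j). A $$ (i div dim_row B, j div dim_col B) * B $$ (i mod dim_row B, j mod dim_col B))"

text \<open>The empty product is the identity matrix of size 1, which is neutral on either side.\<close>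

definition kronecker_list :: "'a :: semiring_1 mat list \<Rightarrow> 'a mat" where
  "kronecker_list As = foldl kronecker (1\<^sub>m 1) As"

primrec kronecker_power :: "'a :: semiring_1 mat \<Rightarrow> nat \<Rightarrow> 'a mat" where
  "kronecker_power A 0 = 1\<^sub>m 1"
| "kronecker_power A (Suc k) = kronecker (kronecker_power A k) A"

lemma kronecker_one_left [simp]: "kronecker (1\<^sub>m (Suc 0)) A = A"
  by (rule eq_matI) (auto simp: kronecker_def)

lemma kronecker_list_single: "kronecker_list [A] = A"
  by (simp add: kronecker_list_def)

lemma kronecker_power_one: "kronecker_power A 1 = A"
  by simp

section \<open>The matrices \<open>M\<close> and \<open>L\<close>\<close>

text \<open>
  Signature of a sequence of distinct numbers: the sign of the permutation of the positions that
  turns the increasing arrangement into the sequence.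
\<close>

definition seq_sign :: "nat list \<Rightarrow> int" where
  "seq_sign js = sign (THE p. p permutes {..<length js} \<and> permute_list p (sort js) = js)"

lemma seq_sign_permute_list:
  assumes p: "p permutes {..<length is}" and "is": "sorted_wrt (<) is"
  shows "seq_sign (permute_list p is) = sign p"
proof -
  have ms: "mset (permute_list p is) = mset is"
    using p by simp
  have srt: "sort (permute_list p is) = is"
    using "is" by (intro properties_for_sort ms[symmetric]) (simp add: strict_sorted_iff)
  have dist: "distinct is"
    using "is" by (simp add: strict_sorted_iff)
  have uniq: "q = p"
    if q: "q permutes {..<length is}" and eq: "permute_list q is = permute_list p is" for q
  proof
    fix i
    show "q i = p i"
    proof (cases "i < length is")
      case True
      then have "is ! q i = is ! p i"
        using arg_cong[OF eq, of "\<lambda>l. l ! i"] p q by (simp add: permute_list_nth)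
      moreover have "q i < length is" "p i < length is"
        using permutes_in_image[OF q, of i] permutes_in_image[OF p, of i] True by auto
      ultimately show ?thesis
        using dist by (simp add: nth_eq_iff_index_eq)
    next
      case False
      then show ?thesis
        using permutes_not_in[OF p, of i] permutes_not_in[OF q, of i] by simp
    qed
  qed
  have "(THE q. q permutes {..<length is} \<and> permute_list q is = permute_list p is) = p"
    by (rule the_equality) (use p uniq in auto)
  then show ?thesis
    by (simp add: seq_sign_def srt)
qed

definition basis_mat :: "nat \<Rightarrow> nat list \<Rightarrow> real mat" where
  "basis_mat n is = mat_of_cols n (map (unit_vec n) is)"

definition basis_tensor :: "nat \<Rightarrow> nat list \<Rightarrow> real mat" where
  "basis_tensor n js = kronecker_list (map (\<lambda>j. mat_of_cols n [unit_vec n j]) js)"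

text \<open>
  The type \<^typ>\<open>real mat\<close> has no zero element, so sums of matrices of a given size are taken in the
  additive group of \<^const>\<open>module_mat\<close>.
\<close>

lemma index_finsum_mat:
  assumes "finite S" and "\<And>s. s \<in> S \<Longrightarrow> f s \<in> carrier_mat nr nc" and "i < nr" and "j < nc"
  shows "finsum (module_mat TYPE(real) nr nc) f S $$ (i, j) = (\<Sum>s\<in>S. f s $$ (i, j))"
proof -
  interpret abelian_group "module_mat TYPE(real) nr nc"
    by (rule abelian_group_mat)
  have "finsum (module_mat TYPE(real) nr nc) f S \<in> carrier_mat nr nc
    \<and> finsum (module_mat TYPE(real) nr nc) f S $$ (i, j) = (\<Sum>s\<in>S. f s $$ (i, j))"
    using assms(1,2)
  proof (induction S rule: finite_induct)
    case empty
    then show ?case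
      using assms(3,4) by (simp add: module_mat_simps)
  next
    case (insert s S)
    have f: "f \<in> S \<rightarrow> carrier (module_mat TYPE(real) nr nc)"
      and fs: "f s \<in> carrier (module_mat TYPE(real) nr nc)"
      using insert.prems by (auto simp: module_mat_simps)
    have "finsum (module_mat TYPE(real) nr nc) f (insert s S)
      = f s + finsum (module_mat TYPE(real) nr nc) f S"
      using finsum_insert[OF insert.hyps f fs] by (simp add: module_mat_simps)
    then show ?case
      using insert assms(3,4) by auto
  qed
  then show ?thesis
    by simp
qed

lemma kronecker_carrier:
  assumes "A \<in> carrier_mat a b" and "B \<in> carrier_mat c d"
  shows "kronecker A B \<in> carrier_mat (a * c) (b * d)"
  using assms by (auto simp: kronecker_def)

lemma basis_tensor_carrier: "basis_tensor n js \<in> carrier_mat (n ^ length js) 1"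
proof (induction js rule: rev_induct)
  case Nil
  then show ?case
    by (simp add: basis_tensor_def kronecker_list_def)
next
  case (snoc j js)
  have "mat_of_cols n [unit_vec n j :: real vec] \<in> carrier_mat n 1"
    using mat_of_cols_carrier(1)[of n "[unit_vec n j]"] by (simp only: list.size One_nat_def add_0)
  from kronecker_carrier[OF snoc this] show ?case
    by (simp only: basis_tensor_def kronecker_list_def map_append list.map foldl_append foldl.simps
        length_append_singleton power_Suc2 mult_1_right)
qed

lemma compound_basis_mat_carrier:
  assumes "length is = k"
  shows "compound k (basis_mat n is) \<in> carrier_mat (n choose k) 1"
  using assms by (simp add: compound_def basis_mat_def)

definition M_mat :: "nat \<Rightarrow> nat \<Rightarrow> real mat" where
  "M_mat n k =
     (\<Oplus>\<^bsub>module_mat TYPE(real) (n ^ k) (n choose k)\<^esub> is \<in> incr_seqs n k.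
       (\<Oplus>\<^bsub>module_mat TYPE(real) (n ^ k) (n choose k)\<^esub> js \<in> permutations_of_multiset (mset is).
         of_int (seq_sign js) \<cdot>\<^sub>m (basis_tensor n js * transpose_mat (compound k (basis_mat n is)))))"

definition L_mat :: "nat \<Rightarrow> nat \<Rightarrow> real mat" where
  "L_mat n k =
     (\<Oplus>\<^bsub>module_mat TYPE(real) (n choose k) (n ^ k)\<^esub> is \<in> incr_seqs n k.
       compound k (basis_mat n is) * transpose_mat (basis_tensor n is))"

lemma M_mat_carrier: "M_mat n k \<in> carrier_mat (n ^ k) (n choose k)"
proof -
  interpret abelian_group "module_mat TYPE(real) (n ^ k) (n choose k)"
    by (rule abelian_group_mat)
  have "of_int (seq_sign js) \<cdot>\<^sub>m (basis_tensor n js * transpose_mat (compound k (basis_mat n is)))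
      \<in> carrier_mat (n ^ k) (n choose k)"
    if "is \<in> incr_seqs n k" "js \<in> permutations_of_multiset (mset is)" for "is" js
  proof -
    have "length is = k" "length js = k"
      using that mset_eq_length[OF permutations_of_multisetD[OF that(2)]]
      by (auto simp: incr_seqs_def)
    then have "basis_tensor n js \<in> carrier_mat (n ^ k) 1"
      "transpose_mat (compound k (basis_mat n is)) \<in> carrier_mat 1 (n choose k)"
      using basis_tensor_carrier[of n js] compound_basis_mat_carrier[of "is" k n]
      by (simp_all only: transpose_carrier_mat)
    then show ?thesis
      by (intro smult_carrier_mat mult_carrier_mat)
  qed
  then have "M_mat n k \<in> carrier (module_mat TYPE(real) (n ^ k) (n choose k))"
    unfolding M_mat_def by (intro finsum_closed Pi_I) (simp only: module_mat_simps)
  then show ?thesis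
    by (simp only: module_mat_simps)
qed

lemma L_mat_carrier: "L_mat n k \<in> carrier_mat (n choose k) (n ^ k)"
proof -
  interpret abelian_group "module_mat TYPE(real) (n choose k) (n ^ k)"
    by (rule abelian_group_mat)
  have "compound k (basis_mat n is) * transpose_mat (basis_tensor n is)
      \<in> carrier_mat (n choose k) (n ^ k)" if "is \<in> incr_seqs n k" for "is"
  proof -
    have "length is = k"
      using that by (simp add: incr_seqs_def)
    then have "compound k (basis_mat n is) \<in> carrier_mat (n choose k) 1"
      "transpose_mat (basis_tensor n is) \<in> carrier_mat 1 (n ^ k)"
      using basis_tensor_carrier[of n "is"] compound_basis_mat_carrier[of "is" k n]
      by (simp_all only: transpose_carrier_mat)
    then show ?thesis
      by (intro mult_carrier_mat)
  qed
  then have "L_mat n k \<in> carrier (module_mat TYPE(real) (n choose k) (n ^ k))"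
    unfolding L_mat_def by (intro finsum_closed Pi_I) (simp only: module_mat_simps)
  then show ?thesis
    by (simp only: module_mat_simps)
qed

end

theory Submission
  imports Defs
begin

text \<open>
  The identity is the Leibniz formula for minors, written with matrices. Number the coordinates of
  a \<open>k\<close>-fold Kronecker product by digit sequences \<open>js\<close>, read in base \<open>n\<close> (\<open>tensor_index\<close>). In these
  coordinates every ingredient has a simple form:

  \<^item> \<open>e\<^sup>j\<^sup>1 \<otimes> \<dots> \<otimes> e\<^sup>j\<^sup>k\<close> is the unit vector at position \<open>tensor_index n js\<close>
    (\<open>basis_tensor_index\<close>);
  \<^item> the entry of the Kronecker power of \<open>A\<close> at the sequences \<open>is\<close> and \<open>js\<close> is the product of the
    entries \<open>A $$ (is ! r, js ! r)\<close> (\<open>kronecker_power_index\<close>);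
  \<^item> the compound of the columns \<open>e\<^sup>i\<^sup>1, \<dots>, e\<^sup>i\<^sup>k\<close>, for an increasing sequence, is the unit vector
    at the lexicographic rank of that sequence (\<open>compound_basis_mat_index\<close>).

  Hence multiplying by \<open>L\<close> from the left selects, for every increasing \<open>\<alpha>\<close>, the row at the index of
  \<open>\<alpha>\<close> (\<open>L_mat_mult_index\<close>), and multiplying by \<open>M\<close> from the right replaces the columns by the signed
  sums over all rearrangements \<open>js\<close> of an increasing \<open>\<beta>\<close> (\<open>mult_M_mat_index\<close>). The \<open>(\<alpha>, \<beta>)\<close> entry of
  the triple product is therefore the sum over the rearrangements \<open>js\<close> of \<open>\<beta>\<close> of the sign of \<open>js\<close>
  times the product of the \<open>A $$ (\<alpha> ! r, js ! r)\<close>. Since the entries of \<open>\<beta>\<close> are distinct, its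
  rearrangements correspond one to one to the permutations of its positions, so that this sum is
  the Leibniz expansion of the minor (\<open>minor_Leibniz\<close>).
\<close>

section \<open>Coordinates of Kronecker products\<close>

text \<open>
  The first factor supplies the most significant digit: a Kronecker product with a factor of size \<open>n\<close>
  on the right moves the index \<open>q\<close> of the left factor to \<open>q * n + j\<close>.
\<close>

definition tensor_index :: "nat \<Rightarrow> nat list \<Rightarrow> nat" where
  "tensor_index n js = foldl (\<lambda>q j. q * n + j) 0 js"

lemma tensor_index_Nil [simp]: "tensor_index n [] = 0"
  by (simp add: tensor_index_def)

lemma tensor_index_snoc [simp]: "tensor_index n (js @ [j]) = tensor_index n js * n + j"
  by (simp add: tensor_index_def)

lemma tensor_index_less:
  assumes "set js \<subseteq> {..<n}"
  shows "tensor_index n js < n ^ length js"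
  using assms
proof (induction js rule: rev_induct)
  case (snoc j js)
  then have "Suc (tensor_index n js) * n \<le> n ^ length js * n"
    by (intro mult_right_mono) auto
  moreover have "j < n"
    using snoc.prems by simp
  ultimately show ?case
    by (simp add: mult.commute)
qed simp

lemma kronecker_power_carrier:
  assumes "A \<in> carrier_mat n m"
  shows "kronecker_power A k \<in> carrier_mat (n ^ k) (m ^ k)"
proof (induction k)
  case (Suc k)
  from kronecker_carrier[OF Suc assms] show ?case
    by (simp add: mult.commute)
qed simp

lemma kronecker_index:
  assumes "A \<in> carrier_mat a b" and "B \<in> carrier_mat c d" and "i < a * c" and "j < b * d"
  shows "kronecker A B $$ (i, j) = A $$ (i div c, j div d) * B $$ (i mod c, j mod d)"
  using assms by (simp add: kronecker_def)

text \<open>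
  Appending a digit matches multiplying by one more factor on the right: division by the size of
  the last factor recovers the shorter sequence, and the remainder is the appended digit.
\<close>

lemma kronecker_power_index:
  assumes A: "A \<in> carrier_mat n m"
    and "length is = k" and "length js = k" and "set is \<subseteq> {..<n}" and "set js \<subseteq> {..<m}"
  shows "kronecker_power A k $$ (tensor_index n is, tensor_index m js)
    = (\<Prod>r<k. A $$ (is ! r, js ! r))"
  using assms(2-)
proof (induction k arbitrary: "is" js)
  case (Suc k)
  obtain is' i where is': "is = is' @ [i]"
    using Suc.prems(1) by (metis length_Suc_conv_rev)
  obtain js' j where js': "js = js' @ [j]"
    using Suc.prems(2) by (metis length_Suc_conv_rev)
  have len: "length is' = k" "length js' = k" and bd: "i < n" "j < m"
    and sub: "set is' \<subseteq> {..<n}" "set js' \<subseteq> {..<m}"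
    using Suc.prems is' js' by auto
  have "tensor_index n is < n ^ k * n" "tensor_index m js < m ^ k * m"
    using tensor_index_less[OF Suc.prems(3)] tensor_index_less[OF Suc.prems(4)] Suc.prems(1,2)
    by (simp_all add: mult.commute)
  then have "kronecker_power A (Suc k) $$ (tensor_index n is, tensor_index m js)
      = kronecker_power A k $$ (tensor_index n is', tensor_index m js') * A $$ (i, j)"
    using bd by (simp add: kronecker_index[OF kronecker_power_carrier[OF A] A] is' js')
  also have "\<dots> = (\<Prod>r<k. A $$ (is' ! r, js' ! r)) * A $$ (i, j)"
    using Suc.IH[OF len sub] by simp
  also have "\<dots> = (\<Prod>r<Suc k. A $$ (is ! r, js ! r))"
    by (simp add: is' js' len nth_append)
  finally show ?case .
qed simp

text \<open>
  The digits of \<open>q\<close> are compared one at a time with \<open>js\<close>; they all agree only if \<open>q\<close> is the index of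
  \<open>js\<close>.
\<close>

lemma basis_tensor_index:
  assumes "set js \<subseteq> {..<n}" and "q < n ^ length js"
  shows "basis_tensor n js $$ (q, 0) = (if q = tensor_index n js then 1 else 0)"
  using assms
proof (induction js arbitrary: q rule: rev_induct)
  case Nil
  then show ?case
    by (simp add: basis_tensor_def kronecker_list_def)
next
  case (snoc j js)
  let ?e = "mat_of_cols n [unit_vec n j :: real vec]"
  have e: "?e \<in> carrier_mat n 1"
    using mat_of_cols_carrier(1)[of n "[unit_vec n j]"] by simp
  have j: "j < n" and js: "set js \<subseteq> {..<n}" and q: "q < n ^ length js * n"
    using snoc.prems by (auto simp: mult.commute)
  have "basis_tensor n (js @ [j]) = kronecker (basis_tensor n js) ?e"
    by (simp add: basis_tensor_def kronecker_list_def)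
  then have "basis_tensor n (js @ [j]) $$ (q, 0)
      = basis_tensor n js $$ (q div n, 0) * ?e $$ (q mod n, 0)"
    using kronecker_index[OF basis_tensor_carrier e, where i = q and j = 0] q by simp
  also have "basis_tensor n js $$ (q div n, 0)
      = (if q div n = tensor_index n js then 1 else 0)"
    using q by (intro snoc.IH js) (simp add: less_mult_imp_div_less)
  also have "?e $$ (q mod n, 0) = (if q mod n = j then 1 else 0)"
    using j by (simp add: mat_of_cols_def)
  finally have "basis_tensor n (js @ [j]) $$ (q, 0)
      = (if q div n = tensor_index n js then 1 else 0) * (if q mod n = j then 1 else 0)" .
  moreover have "q = tensor_index n js * n + j \<longleftrightarrow> q div n = tensor_index n js \<and> q mod n = j"
    using j div_mult_mod_eq[of q n] by (metis div_mult_self3 div_less mod_mult_self3 mod_less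
        add.right_neutral less_nat_zero_code)
  ultimately show ?case
    by simp
qed

section \<open>Compounds of basis vectors\<close>

lemma incr_seqs_self: "incr_seqs k k = {[0..<k]}"
proof -
  have "[0..<k] \<in> incr_seqs k k"
    by (auto simp: incr_seqs_def)
  moreover have "card (incr_seqs k k) = 1"
    by (simp add: card_incr_seqs)
  ultimately show ?thesis
    by (metis card_1_singletonE singletonD)
qed

text \<open>
  Two different increasing sequences of the same length have different sets of entries, so
  some \<open>\<alpha> ! r\<close> does not occur in \<open>is\<close>, and row \<open>r\<close> of the submatrix vanishes. For \<open>\<alpha> = is\<close> the
  submatrix is the identity.
\<close>

lemma minor_basis_mat:
  assumes \<alpha>: "\<alpha> \<in> incr_seqs n k" and "is": "is \<in> incr_seqs n k"
  shows "minor (basis_mat n is) \<alpha> [0..<k] = (if \<alpha> = is then 1 else 0)"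
proof -
  have len: "length \<alpha> = k" "length is = k" and bd: "set \<alpha> \<subseteq> {..<n}" "set is \<subseteq> {..<n}"
    and srt: "sorted_wrt (<) \<alpha>" "sorted_wrt (<) is"
    using assms by (auto simp: incr_seqs_def)
  let ?D = "mat k k (\<lambda>(r, s). if \<alpha> ! r = is ! s then 1 else 0 :: real)"
  have "mat k k (\<lambda>(r, s). basis_mat n is $$ (\<alpha> ! r, [0..<k] ! s)) = ?D"
    using len bd by (intro eq_matI) (auto simp: basis_mat_def mat_of_cols_def subset_iff)
  then have minor: "minor (basis_mat n is) \<alpha> [0..<k] = det ?D"
    by (simp add: minor_def len)
  show ?thesis
  proof (cases "\<alpha> = is")
    case True
    have "?D = 1\<^sub>m k"
      using True len srt by (intro eq_matI) (auto simp: nth_eq_iff_index_eq strict_sorted_iff)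
    then show ?thesis
      using True minor by simp
  next
    case False
    have "\<not> set \<alpha> \<subseteq> set is"
    proof
      assume "set \<alpha> \<subseteq> set is"
      then have "set \<alpha> = set is"
        using len srt by (intro card_subset_eq) (auto simp: strict_sorted_iff distinct_card)
      with False srt show False
        by (simp add: strict_sorted_equal)
    qed
    then obtain r where r: "r < k" "\<alpha> ! r \<notin> set is"
      using len by (auto simp: in_set_conv_nth subset_iff)
    have "?D = mat\<^sub>r k k (\<lambda>i. if i = r then 0\<^sub>v k else row ?D i)"
      using r len by (intro eq_matI) auto
    moreover have "det \<dots> = 0"
      by (rule det_row_0[OF r(1)]) auto
    ultimately have "det ?D = 0"
      by simp
    then show ?thesis
      using False minor by simp
  qed
qed

lemma lex_seqs_nth: "p < n choose k \<Longrightarrow> lex_seqs n k ! p \<in> incr_seqs n k"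
  by (metis length_lex_seqs nth_mem set_lex_seqs)

lemma compound_basis_mat_index:
  assumes "is \<in> incr_seqs n k" and p: "p < n choose k"
  shows "compound k (basis_mat n is) $$ (p, 0) = (if lex_seqs n k ! p = is then 1 else 0)"
proof -
  have "length is = k"
    using assms by (simp add: incr_seqs_def)
  then have "compound k (basis_mat n is) $$ (p, 0)
      = minor (basis_mat n is) (lex_seqs n k ! p) (lex_seqs k k ! 0)"
    using p by (simp add: compound_def basis_mat_def)
  also have "lex_seqs k k = [[0..<k]]"
    by (simp add: lex_seqs_def incr_seqs_self)
  finally show ?thesis
    using minor_basis_mat[OF lex_seqs_nth[OF p] assms(1)] by simp
qed

section \<open>Multiplication by \<open>L\<close> and \<open>M\<close>\<close>

lemma mult_transpose_index:
  assumes "u \<in> carrier_mat a 1" and "v \<in> carrier_mat b 1" and "i < a" and "j < b"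
  shows "(u * transpose_mat v) $$ (i, j) = u $$ (i, 0) * v $$ (j, 0)"
  using assms by (simp add: scalar_prod_def)

text \<open>
  Row \<open>p\<close> of the summand for \<open>is\<close> vanishes unless \<open>is\<close> is the \<open>p\<close>-th increasing sequence, so a single
  summand contributes to the row.
\<close>

lemma L_mat_index:
  assumes p: "p < n choose k" and q: "q < n ^ k"
  shows "L_mat n k $$ (p, q) = (if q = tensor_index n (lex_seqs n k ! p) then 1 else 0)"
proof -
  let ?f = "\<lambda>is. compound k (basis_mat n is) * transpose_mat (basis_tensor n is)"
  have car: "compound k (basis_mat n is) \<in> carrier_mat (n choose k) 1"
      "basis_tensor n is \<in> carrier_mat (n ^ k) 1"
    if "is \<in> incr_seqs n k" for "is"
    using that compound_basis_mat_carrier[of "is" k n] basis_tensor_carrier[of n "is"]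
    by (auto simp: incr_seqs_def)
  have "L_mat n k $$ (p, q) = (\<Sum>is\<in>incr_seqs n k. ?f is $$ (p, q))"
    unfolding L_mat_def
    by (rule index_finsum_mat)
      (use p q car in \<open>auto intro!: mult_carrier_mat simp only: transpose_carrier_mat finite_incr_seqs\<close>)
  also have "\<dots> = (\<Sum>is\<in>incr_seqs n k. if lex_seqs n k ! p = is
      then if q = tensor_index n (lex_seqs n k ! p) then 1 else 0 else 0)"
  proof (rule sum.cong[OF refl])
    fix "is" assume "is": "is \<in> incr_seqs n k"
    show "?f is $$ (p, q) = (if lex_seqs n k ! p = is
      then if q = tensor_index n (lex_seqs n k ! p) then 1 else 0 else 0)"
      using "is" p q
      by (subst mult_transpose_index[OF car[OF "is"] p q])
        (auto simp: compound_basis_mat_index basis_tensor_index incr_seqs_def)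
  qed
  also have "\<dots> = (if q = tensor_index n (lex_seqs n k ! p) then 1 else 0)"
    using lex_seqs_nth[OF p] by simp
  finally show ?thesis .
qed

lemma permutation_of_incr_seqD:
  assumes "is \<in> incr_seqs n k" and "js \<in> permutations_of_multiset (mset is)"
  shows "length js = k" and "set js \<subseteq> {..<n}"
  using assms mset_eq_length[OF permutations_of_multisetD[OF assms(2)]]
    mset_eq_setD[OF permutations_of_multisetD[OF assms(2)]]
  by (auto simp: incr_seqs_def)

text \<open>
  As for \<open>L\<close>, the compound factor keeps in column \<open>t\<close> only the \<open>t\<close>-th increasing sequence; what
  remains is the signed sum over its rearrangements.
\<close>

lemma M_mat_index:
  assumes q: "q < n ^ k" and t: "t < n choose k"
  shows "M_mat n k $$ (q, t) = (\<Sum>js\<in>permutations_of_multiset (mset (lex_seqs n k ! t)).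
    if q = tensor_index n js then of_int (seq_sign js) else 0)"
proof -
  let ?P = "\<lambda>is :: nat list. permutations_of_multiset (mset is)"
  let ?f = "\<lambda>is js. of_int (seq_sign js)
    \<cdot>\<^sub>m (basis_tensor n js * transpose_mat (compound k (basis_mat n is)))"
  let ?G = "module_mat TYPE(real) (n ^ k) (n choose k)"
  interpret abelian_group ?G
    by (rule abelian_group_mat)
  have compound_car: "compound k (basis_mat n is) \<in> carrier_mat (n choose k) 1"
    if "is \<in> incr_seqs n k" for "is"
    using that compound_basis_mat_carrier[of "is" k n] by (auto simp: incr_seqs_def)
  have tensor_car: "basis_tensor n js \<in> carrier_mat (n ^ k) 1"
    if "is \<in> incr_seqs n k" "js \<in> ?P is" for "is" js
    using permutation_of_incr_seqD(1)[OF that] basis_tensor_carrier[of n js] by simp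
  have f_car: "?f is js \<in> carrier_mat (n ^ k) (n choose k)"
    if "is \<in> incr_seqs n k" "js \<in> ?P is" for "is" js
    using tensor_car[OF that] compound_car[OF that(1)] by simp
  have inner_car: "finsum ?G (?f is) (?P is) \<in> carrier_mat (n ^ k) (n choose k)"
    if "is \<in> incr_seqs n k" for "is"
  proof -
    have "finsum ?G (?f is) (?P is) \<in> carrier ?G"
      using f_car[OF that] by (intro finsum_closed Pi_I) (simp only: module_mat_simps)
    then show ?thesis
      by (simp only: module_mat_simps)
  qed
  have "M_mat n k $$ (q, t) = (\<Sum>is\<in>incr_seqs n k. finsum ?G (?f is) (?P is) $$ (q, t))"
    unfolding M_mat_def using q t inner_car by (intro index_finsum_mat) auto
  also have "\<dots> = (\<Sum>is\<in>incr_seqs n k. \<Sum>js\<in>?P is. ?f is js $$ (q, t))"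
    using q t f_car by (intro sum.cong index_finsum_mat) auto
  also have "\<dots> = (\<Sum>is\<in>incr_seqs n k. if lex_seqs n k ! t = is
      then \<Sum>js\<in>?P is. if q = tensor_index n js then of_int (seq_sign js) else 0 else 0)"
  proof (rule sum.cong[OF refl])
    fix "is" assume "is": "is \<in> incr_seqs n k"
    have "?f is js $$ (q, t) = (if lex_seqs n k ! t = is
        then if q = tensor_index n js then of_int (seq_sign js) else 0 else 0)"
      if js: "js \<in> ?P is" for js
    proof -
      note js_bd = permutation_of_incr_seqD[OF "is" js]
      have "(basis_tensor n js * transpose_mat (compound k (basis_mat n is))) $$ (q, t)
          = basis_tensor n js $$ (q, 0) * compound k (basis_mat n is) $$ (t, 0)"
        by (rule mult_transpose_index[OF tensor_car[OF "is" js] compound_car[OF "is"] q t])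
      also have "\<dots> = (if lex_seqs n k ! t = is
          then if q = tensor_index n js then 1 else 0 else 0)"
        using q t "is" js_bd by (simp add: compound_basis_mat_index basis_tensor_index)
      finally show ?thesis
        using q t tensor_car[OF "is" js] compound_car[OF "is"] by simp
    qed
    then show "(\<Sum>js\<in>?P is. ?f is js $$ (q, t)) = (if lex_seqs n k ! t = is
        then \<Sum>js\<in>?P is. if q = tensor_index n js then of_int (seq_sign js) else 0 else 0)"
      by simp
  qed
  also have "\<dots> = (\<Sum>js\<in>?P (lex_seqs n k ! t).
      if q = tensor_index n js then of_int (seq_sign js) else 0)"
    using lex_seqs_nth[OF t] by simp
  finally show ?thesis .
qed

lemma L_mat_mult_index:
  assumes B: "B \<in> carrier_mat (n ^ k) c" and p: "p < n choose k" and j: "j < c"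
  shows "(L_mat n k * B) $$ (p, j) = B $$ (tensor_index n (lex_seqs n k ! p), j)"
proof -
  have less: "tensor_index n (lex_seqs n k ! p) < n ^ k"
    using lex_seqs_nth[OF p] tensor_index_less[of "lex_seqs n k ! p" n] by (simp add: incr_seqs_def)
  have "(L_mat n k * B) $$ (p, j) = (\<Sum>q<n ^ k. L_mat n k $$ (p, q) * B $$ (q, j))"
    using B p j L_mat_carrier[of n k] by (simp add: scalar_prod_def lessThan_atLeast0)
  also have "\<dots> = (\<Sum>q<n ^ k. if q = tensor_index n (lex_seqs n k ! p) then B $$ (q, j) else 0)"
    by (intro sum.cong) (simp_all add: L_mat_index p)
  finally show ?thesis
    using less by simp
qed

lemma mult_M_mat_index:
  assumes B: "B \<in> carrier_mat r (n ^ k)" and i: "i < r" and t: "t < n choose k"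
  shows "(B * M_mat n k) $$ (i, t) = (\<Sum>js\<in>permutations_of_multiset (mset (lex_seqs n k ! t)).
    of_int (seq_sign js) * B $$ (i, tensor_index n js))"
proof -
  let ?P = "permutations_of_multiset (mset (lex_seqs n k ! t))"
  have "(B * M_mat n k) $$ (i, t) = (\<Sum>q<n ^ k. B $$ (i, q) * M_mat n k $$ (q, t))"
    using B i t M_mat_carrier[of n k] by (simp add: scalar_prod_def lessThan_atLeast0)
  also have "\<dots> = (\<Sum>q<n ^ k. \<Sum>js\<in>?P.
      if q = tensor_index n js then of_int (seq_sign js) * B $$ (i, q) else 0)"
    using t by (intro sum.cong) (auto simp: M_mat_index sum_distrib_left intro!: sum.cong)
  also have "\<dots> = (\<Sum>js\<in>?P. \<Sum>q<n ^ k.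
      if q = tensor_index n js then of_int (seq_sign js) * B $$ (i, q) else 0)"
    by (rule sum.swap)
  also have "\<dots> = (\<Sum>js\<in>?P. of_int (seq_sign js) * B $$ (i, tensor_index n js))"
  proof (rule sum.cong[OF refl])
    fix js assume "js \<in> ?P"
    then have "tensor_index n js < n ^ k"
      using permutation_of_incr_seqD[OF lex_seqs_nth[OF t]] tensor_index_less by metis
    then show "(\<Sum>q<n ^ k. if q = tensor_index n js then of_int (seq_sign js) * B $$ (i, q) else 0)
        = of_int (seq_sign js) * B $$ (i, tensor_index n js)"
      by simp
  qed
  finally show ?thesis .
qed

section \<open>The Leibniz formula over rearrangements\<close>

lemma bij_betw_permute_list:
  assumes "distinct xs"
  shows "bij_betw (\<lambda>p. permute_list p xs) {p. p permutes {..<length xs}}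
    (permutations_of_multiset (mset xs))"
proof (rule bij_betw_imageI)
  show "inj_on (\<lambda>p. permute_list p xs) {p. p permutes {..<length xs}}"
  proof (rule inj_onI)
    fix p q
    assume "p \<in> {p. p permutes {..<length xs}}" "q \<in> {p. p permutes {..<length xs}}"
      and eq: "permute_list p xs = permute_list q xs"
    then have p: "p permutes {..<length xs}" and q: "q permutes {..<length xs}"
      by auto
    have "p i = q i" if i: "i < length xs" for i
    proof -
      have "xs ! p i = xs ! q i"
        using arg_cong[OF eq, of "\<lambda>l. l ! i"] p q i by (simp add: permute_list_nth)
      then show ?thesis
        using assms i permutes_in_image[OF p, of i] permutes_in_image[OF q, of i]
        by (simp add: nth_eq_iff_index_eq)
    qed
    then show "p = q"
      using permutes_not_in[OF p] permutes_not_in[OF q] by (metis ext lessThan_iff)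
  qed
  show "(\<lambda>p. permute_list p xs) ` {p. p permutes {..<length xs}}
      = permutations_of_multiset (mset xs)"
    by (auto simp: permutations_of_multiset_def image_iff elim!: mset_eq_permutation)
qed

text \<open>
  The Leibniz formula sums over permutations \<open>p\<close> of positions. As \<open>\<beta>\<close> is increasing, \<open>p\<close> can be
  recovered from the rearrangement \<open>permute_list p \<beta>\<close>, and its sign is the signature of that
  sequence, which allows the sum to run over rearrangements instead.
\<close>

lemma minor_Leibniz:
  assumes \<beta>: "sorted_wrt (<) \<beta>" and len: "length \<alpha> = length \<beta>"
  shows "minor A \<alpha> \<beta> = (\<Sum>js\<in>permutations_of_multiset (mset \<beta>).
    of_int (seq_sign js) * (\<Prod>r<length \<beta>. A $$ (\<alpha> ! r, js ! r)))"
proof -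
  let ?k = "length \<beta>"
  have "minor A \<alpha> \<beta> = (\<Sum>p | p permutes {..<?k}.
      of_int (sign p) * (\<Prod>r<?k. A $$ (\<alpha> ! r, \<beta> ! p r)))"
    using permutes_in_image
    by (fastforce simp: minor_def det_def len lessThan_atLeast0 intro!: sum.cong prod.cong)
  also have "\<dots> = (\<Sum>p | p permutes {..<?k}. of_int (seq_sign (permute_list p \<beta>))
      * (\<Prod>r<?k. A $$ (\<alpha> ! r, permute_list p \<beta> ! r)))"
    using \<beta> by (intro sum.cong) (simp_all add: seq_sign_permute_list permute_list_nth)
  also have "\<dots> = (\<Sum>js\<in>permutations_of_multiset (mset \<beta>).
      of_int (seq_sign js) * (\<Prod>r<?k. A $$ (\<alpha> ! r, js ! r)))"
    using \<beta> by (intro sum.reindex_bij_betw bij_betw_permute_list) (simp add: strict_sorted_iff)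
  finally show ?thesis .
qed

theorem theorem3:
  fixes n m k :: nat and A :: "real mat"
  assumes "n \<ge> 1" and "m \<ge> 1"
    and "A \<in> carrier_mat n m"
    and "k \<in> {1..min n m}"
  shows "compound k A = L_mat n k * kronecker_power A k * M_mat m k"
proof (rule eq_matI)
  note A = assms(3)
  note K = kronecker_power_carrier[OF A, of k]
  note LK = mult_carrier_mat[OF L_mat_carrier K]
  fix p t
  assume "p < dim_row (L_mat n k * kronecker_power A k * M_mat m k)"
    and "t < dim_col (L_mat n k * kronecker_power A k * M_mat m k)"
  then have p: "p < n choose k" and t: "t < m choose k"
    using L_mat_carrier[of n k] M_mat_carrier[of m k] by simp_all
  define \<alpha> where "\<alpha> = lex_seqs n k ! p"
  define \<beta> where "\<beta> = lex_seqs m k ! t"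
  have \<alpha>: "\<alpha> \<in> incr_seqs n k" and \<beta>: "\<beta> \<in> incr_seqs m k"
    by (simp_all only: \<alpha>_def \<beta>_def lex_seqs_nth p t)
  have "(L_mat n k * kronecker_power A k * M_mat m k) $$ (p, t)
      = (\<Sum>js\<in>permutations_of_multiset (mset \<beta>).
          of_int (seq_sign js) * (L_mat n k * kronecker_power A k) $$ (p, tensor_index m js))"
    unfolding \<beta>_def by (rule mult_M_mat_index[OF LK p t])
  also have "\<dots> = (\<Sum>js\<in>permutations_of_multiset (mset \<beta>).
      of_int (seq_sign js) * (\<Prod>r<k. A $$ (\<alpha> ! r, js ! r)))"
  proof (rule sum.cong[OF refl])
    fix js assume "js \<in> permutations_of_multiset (mset \<beta>)"
    note js = permutation_of_incr_seqD[OF \<beta> this]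
    have "(L_mat n k * kronecker_power A k) $$ (p, tensor_index m js)
        = kronecker_power A k $$ (tensor_index n \<alpha>, tensor_index m js)"
      unfolding \<alpha>_def using tensor_index_less[OF js(2)] js(1)
      by (intro L_mat_mult_index[OF K p]) simp
    also have "\<dots> = (\<Prod>r<k. A $$ (\<alpha> ! r, js ! r))"
      using \<alpha> js by (intro kronecker_power_index[OF A]) (auto simp: incr_seqs_def)
    finally show "of_int (seq_sign js)
          * (L_mat n k * kronecker_power A k) $$ (p, tensor_index m js)
        = of_int (seq_sign js) * (\<Prod>r<k. A $$ (\<alpha> ! r, js ! r))"
      by simp
  qed
  also have "\<dots> = minor A \<alpha> \<beta>"
    using \<alpha> \<beta> by (subst minor_Leibniz) (auto simp: incr_seqs_def)
  also have "\<dots> = compound k A $$ (p, t)"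
    using A p t by (simp add: compound_def \<alpha>_def \<beta>_def)
  finally show "compound k A $$ (p, t) = (L_mat n k * kronecker_power A k * M_mat m k) $$ (p, t)"
    by simp
qed (use assms(3) L_mat_carrier[of n k] M_mat_carrier[of m k] in \<open>simp_all add: compound_def\<close>)

end
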